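(* Let $m$ be a positive integer, let $n\in\{2m,2m+1\}$, and let $F(x)=x^{2^{m+1}-1}$ be the power mapping on $\mathbb{F}_{2^n}$. Let $a,b\in\mathbb{F}_{2^n}$. Then: (i) if $a=0$ and $b=0$, then $\mathrm{DDT}_F(a,b)=2^n$; (ii) if $a=0$ and $b\neq 0$, then $\mathrm{DDT}_F(a,b)=0$; (iii) if $a\neq 0$ and $b=0$, then $\mathrm{DDT}_F(a,b)=0$ when $n=2m+1$; and when $n=2m$, $\mathrm{DDT}_F(a,b)=2$ if $m$ is odd and $\mathrm{DDT}_F(a,b)=0$ if $m$ is even; (iv) if $a\neq 0$ and $b\neq 0$, put $t=\frac{b}{a^{2^{m+1}-1}}$. When $n=2m+1$, $$\mathrm{DDT}_F(a,b)=\begin{cases}2,&\text{if }\mathrm{Tr}_1^n\left(\frac{1}{t^{2^m+1}}\right)=1;\\ 0,&\text{if }\mathrm{Tr}_1^n\left(\frac{1}{t^{2^m+1}}\right)=0.\end{cases}$$ When $n=2m$, $$\mathrm{DDT}_F(a,b)=\begin{cases}2^m,&\text{if }t=1;\\ 2,&\text{if }t^{2^m+1}\neq 1\text{ and }\mathrm{Tr}_1^m\left(\frac{t^{2^m}+t+1}{t^{2^{m+1}+2}+1}\right)=1;\\ 0,&\text{if }t\neq 1\text{ and }t^{2^m+1}=1,\\ &\text{or }t^{2^m+1}\neq 1\text{ and }\mathrm{Tr}_1^m\left(\frac{t^{2^m}+t+1}{t^{2^{m+1}+2}+1}\right)=0.\end{cases}$$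
   Context: $\mathbb{F}_{2^n}$ is the finite field with $2^n$ elements. For a positive integer $k$, $\mathrm{Tr}_1^k(x)=\sum_{i=0}^{k-1}x^{2^i}$ is the absolute trace from $\mathbb{F}_{2^k}$ to $\mathbb{F}_2$. When $n=2m$, $\mathbb{F}_{2^m}$ is regarded as the subfield of $\mathbb{F}_{2^n}$ of order $2^m$, and the arguments to which $\mathrm{Tr}_1^m$ is applied lie in this subfield. For a mapping $F:\mathbb{F}_{2^n}\to\mathbb{F}_{2^n}$ and $(a,b)\in\mathbb{F}_{2^n}^2$, the Difference Distribution Table (DDT) entry is $$\mathrm{DDT}_F(a,b)=|\{x\in\mathbb{F}_{2^n}: F(x)+F(x+a)=b\}|.$$ *)

theory Defs
  imports "HOL-Library.Cardinality"
begin

definition DDT :: "('a::{field,finite} \<Rightarrow> 'a) \<Rightarrow> 'a \<Rightarrow> 'a \<Rightarrow> nat" where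
  "DDT F a b = card {x. F x + F (x + a) = b}"

(* abs_trace k is the absolute trace of the subfield {x. x ^ 2 ^ k = x} of order 2 ^ k.
   It is given by its formula on the whole ambient field; off that subfield
   the value need not lie in {0, 1} and has no meaning as a trace. *)
definition abs_trace :: "nat \<Rightarrow> 'a::field \<Rightarrow> 'a" where
  "abs_trace k x = (\<Sum>i<k. x ^ (2 ^ i))"

end

theory Submission
  imports Defs "HOL-Computational_Algebra.Primes"
    "HOL-Computational_Algebra.Polynomial"
begin

text \<open>
  Put \<open>q = 2 ^ m\<close>. Scaling reduces to \<open>a = 1\<close>, and for \<open>y \<noteq> 0, 1\<close> the equation becomes
  \<open>y ^ (2 * q) + y = t * (y\<^sup>2 + y)\<close>. Comparing it with its \<open>q\<close>-th power determines both
  \<open>A = y\<^sup>2 + y\<close> and \<open>s = y ^ q + y\<close> as rational functions of \<open>t\<close> and \<open>t ^ q\<close> (unless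
  \<open>n = 2 * m\<close> and \<open>t ^ (q + 1) = 1\<close>), and conversely these two values imply the equation. So there
  are at most two solutions, and since \<open>y ^ q + y = abs_trace m A\<close> for any root of \<open>y\<^sup>2 + y = A\<close>,
  the remaining condition is \<open>abs_trace m A = s\<close>. Splitting off from \<open>A\<close> a term of the form
  \<open>g\<^sup>2 + g\<close> turns it into the stated trace condition.
\<close>

section \<open>Finite fields in general: fibres, the Frobenius identity, scaling of
  differences\<close>

lemma card_UNIV_additive:
  fixes f :: "'a::{ab_group_add,finite} \<Rightarrow> 'b::ab_group_add"
  assumes add: "\<And>x y. f (x + y) = f x + f y"
  shows "CARD('a) = card (range f) * card {x. f x = 0}"
proof -
  \<comment> \<open>Each nonempty fibre is a translate of the kernel.\<close>
  have fibre: "card {x. f x = f y} = card {x. f x = 0}" for y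
  proof -
    have 0: "f (x + y) = f y \<longleftrightarrow> f x = 0" for x
      by (simp add: add)
    have "{x. f x = f y} = (\<lambda>x. x + y) ` {x. f x = 0}"
    proof (intro equalityI subsetI)
      fix x assume "x \<in> {x. f x = f y}"
      then show "x \<in> (\<lambda>x. x + y) ` {x. f x = 0}"
        using 0[of "x - y"] by (intro image_eqI[of _ _ "x - y"]) auto
    qed (auto simp: 0)
    then show ?thesis
      by (simp add: card_image)
  qed
  have "CARD('a) = (\<Sum>z\<in>range f. card {x \<in> UNIV. f x = z})"
    using sum_fun_comp[of "UNIV :: 'a set" "range f" f "\<lambda>_. 1 :: nat"] by simp
  also have "\<dots> = (\<Sum>z\<in>range f. card {x. f x = 0})"
    by (rule sum.cong) (auto simp: fibre)
  finally show ?thesis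
    by simp
qed

text \<open>Multiplication by a nonzero \<open>x\<close> permutes the nonzero elements; comparing
  the products over them leaves a power of \<open>x\<close> equal to \<open>1\<close>.\<close>

lemma power_CARD_eq_self:
  fixes x :: "'a::{field,finite}"
  shows "x ^ CARD('a) = x"
proof (cases "x = 0")
  case False
  let ?U = "UNIV - {0 :: 'a}"
  have "bij_betw ((*) x) ?U ?U"
    using False by (intro bij_betw_byWitness[where f' = "\<lambda>y. y / x"]) auto
  then have "prod id ?U = (\<Prod>y\<in>?U. x * y)"
    using prod.reindex_bij_betw[of "(*) x" ?U ?U id] by simp
  also have "\<dots> = x ^ card ?U * prod id ?U"
    by (simp add: prod.distrib)
  finally have "x ^ card ?U = 1"
    by simp
  moreover have "CARD('a) = Suc (card ?U)"
    by (rule card.remove) auto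
  ultimately show ?thesis
    by (simp only: power_Suc mult_1_right)
qed (simp add: zero_less_card_finite)

lemma DDT_power_reduce:
  fixes a b :: "'a::{field,finite}"
  assumes "a \<noteq> 0"
  shows "DDT (\<lambda>x. x ^ d) a b = DDT (\<lambda>x. x ^ d) 1 (b / a ^ d)"
proof -
  let ?R = "{y. y ^ d + (y + 1) ^ d = b / a ^ d}"
  have *: "(a * y) ^ d + (a * y + a) ^ d = b \<longleftrightarrow> y \<in> ?R" for y
  proof -
    have "(a * y) ^ d + (a * y + a) ^ d = a ^ d * (y ^ d + (y + 1) ^ d)"
      by (simp add: distrib_left flip: power_mult_distrib)
    then show ?thesis
      using assms by (auto simp: field_simps)
  qed
  have "{x. x ^ d + (x + a) ^ d = b} = (*) a ` ?R"
  proof (intro equalityI subsetI)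
    fix x assume "x \<in> {x. x ^ d + (x + a) ^ d = b}"
    then show "x \<in> (*) a ` ?R"
      using *[of "x / a"] assms by (intro image_eqI[of _ _ "x / a"]) auto
  qed (use * in auto)
  moreover have "inj_on ((*) a) ?R"
    using assms by (auto intro: inj_onI)
  ultimately show ?thesis
    by (simp add: DDT_def card_image)
qed

section \<open>Arithmetic in characteristic two\<close>

locale binary_field =
  fixes n :: nat and ty :: "'a::{field,finite} itself"
  assumes card: "CARD('a) = 2 ^ n"
begin

lemma CHAR_2: "CHAR('a) = 2"
proof -
  \<comment> \<open>Translation by \<open>1\<close> permutes the field, so the sum of
    \<open>1\<close> over all elements, which is \<open>2 ^ n\<close>, vanishes.\<close>
  have "(\<Sum>x\<in>UNIV. x + (1::'a)) = (\<Sum>x\<in>UNIV. x)"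
    by (rule sum.reindex_bij_witness[of _ "\<lambda>x. x - 1" "\<lambda>x. x + 1"]) auto
  then have "(2::'a) ^ n = 0"
    using arg_cong[OF card, of "of_nat :: nat \<Rightarrow> 'a"] by (simp add: sum.distrib)
  then have "of_nat 2 = (0::'a)"
    by auto
  then show ?thesis
    by (rule CHAR_eq_posI[rotated]) (auto simp: less_2_cases_iff)
qed

lemma prime_CHAR: "prime CHAR('a)"
  by (simp add: CHAR_2)

lemma two_eq_0: "(2::'a) = 0"
  using of_nat_CHAR[where 'a = 'a] by (simp add: CHAR_2)

lemma add_self: "x + x = (0::'a)"
  by (simp add: two_eq_0 flip: mult_2)

lemma add_self_left: "x + (x + y) = (y::'a)"
  by (simp add: add_self flip: add.assoc)

lemma add_eq_0_iff': "x + y = 0 \<longleftrightarrow> x = (y::'a)"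
  using minus_CHAR_2[OF CHAR_2, of x y] by (metis eq_iff_diff_eq_0)

lemma add_eq_iff: "x + y = z \<longleftrightarrow> x = y + (z::'a)"
  by (metis add.commute add_self_left)

lemmas char2_simps = algebra_simps power2_eq_square add_self add_self_left two_eq_0

lemma frob_add: "(x + y) ^ (2 ^ k) = x ^ (2 ^ k) + (y::'a) ^ (2 ^ k)"
  by (rule freshmans_dream'[OF prime_CHAR]) (simp add: CHAR_2)

lemma square_add: "(x + y)\<^sup>2 = x\<^sup>2 + (y::'a)\<^sup>2"
  using frob_add[of x y 1] by simp

lemma frob_n: "(x::'a) ^ (2 ^ n) = x"
  using power_CARD_eq_self[of x] by (simp add: card)

lemma frob_frob: "(x ^ (2 ^ j)) ^ (2 ^ k) = (x::'a) ^ (2 ^ (j + k))"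
  by (simp add: power_add power_mult)

lemma square_eq_iff: "x\<^sup>2 = y\<^sup>2 \<longleftrightarrow> x = (y::'a)"
  using square_add[of x y] by (metis add_eq_0_iff' power2_eq_iff add_self zero_eq_power2)

lemma artin_schreier_eq_iff: "y\<^sup>2 + y = w\<^sup>2 + w \<longleftrightarrow> y = w \<or> y = w + (1::'a)"
proof -
  have "y\<^sup>2 + y + (w\<^sup>2 + w) = (y + w) * (y + (w + 1))"
    by (simp add: char2_simps)
  then show ?thesis
    by (metis add_eq_0_iff' mult_eq_0_iff)
qed

lemma artin_schreier_eq_0_iff: "y\<^sup>2 + y = 0 \<longleftrightarrow> y = 0 \<or> y = (1::'a)"
  using artin_schreier_eq_iff[of y 0] by simp

lemma card_artin_schreier:
  assumes "w\<^sup>2 + w = (c::'a)"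
  shows "card {y. y\<^sup>2 + y = c} = 2"
proof -
  have "{y. y\<^sup>2 + y = c} = {w, w + 1}"
    using assms artin_schreier_eq_iff by auto
  then show ?thesis
    by simp
qed

section \<open>The trace formula and Artin-Schreier equations\<close>

lemma abs_trace_add: "abs_trace k (x + y) = abs_trace k x + abs_trace k (y::'a)"
  by (simp add: abs_trace_def frob_add sum.distrib)

lemma abs_trace_frob: "abs_trace k (x::'a) ^ (2 ^ j) = abs_trace k (x ^ (2 ^ j))"
proof -
  have "(\<Sum>i<k. x ^ (2 ^ i)) ^ (2 ^ j) = (\<Sum>i<k. (x ^ (2 ^ i)) ^ (2 ^ j))"
    by (rule freshmans_dream_sum'[OF prime_CHAR]) (simp add: CHAR_2)
  then show ?thesis
    by (simp add: abs_trace_def frob_frob add.commute)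
qed

lemma abs_trace_split: "abs_trace (j + k) (x::'a) = abs_trace j x + abs_trace k x ^ (2 ^ j)"
  by (induction k) (simp_all add: abs_trace_def frob_add frob_frob add_ac)

text \<open>The sum telescopes. Taking \<open>k = n\<close> puts the range of
  \<open>y\<^sup>2 + y\<close> into the trace kernel; taking \<open>k = m\<close> computes
  \<open>y ^ q + y\<close> from \<open>y\<^sup>2 + y\<close>.\<close>

lemma abs_trace_artin_schreier: "abs_trace k ((x::'a)\<^sup>2 + x) = x ^ (2 ^ k) + x"
proof (induction k)
  case (Suc k)
  have "(x\<^sup>2) ^ (2 ^ k) = x ^ (2 ^ Suc k)"
    by (simp flip: power_mult)
  then show ?case
    using Suc by (simp add: abs_trace_def frob_add char2_simps)
qed (simp add: abs_trace_def add_self)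

lemma abs_trace_square_add: "(abs_trace k (x::'a))\<^sup>2 + abs_trace k x = x ^ (2 ^ k) + x"
  using abs_trace_frob[of k x 1] abs_trace_artin_schreier[of k x] by (simp add: abs_trace_add)

lemma abs_trace_of_1: "abs_trace k (1::'a) = of_bool (odd k)"
  by (simp add: abs_trace_def) (auto elim!: evenE oddE simp: two_eq_0)

text \<open>The trace is a nonzero polynomial function of degree at most \<open>2 ^ (n - 1)\<close>,
  which bounds the number of its roots.\<close>

lemma card_abs_trace_kernel:
  assumes "n > 0"
  shows "card {x::'a. abs_trace n x = 0} \<le> 2 ^ (n - 1)"
proof -
  let ?p = "\<Sum>i<n. monom (1::'a) (2 ^ i)"
  have "coeff ?p (2 ^ (n - 1)) = (\<Sum>i<n. if i = n - 1 then 1 else 0)"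
    by (auto simp: coeff_sum intro!: sum.cong)
  then have "?p \<noteq> 0"
    using assms by (auto simp: sum.delta)
  moreover have "degree ?p \<le> 2 ^ (n - 1)"
    by (intro degree_sum_le) (auto intro!: order.trans[OF degree_monom_le] power_increasing)
  ultimately show ?thesis
    using card_poly_roots_bound[of ?p] by (simp add: abs_trace_def poly_sum poly_monom)
qed

text \<open>Additive Hilbert 90, by counting: \<open>y \<mapsto> y\<^sup>2 + y\<close> is two-to-one into the trace kernel.\<close>
lemma artin_schreier_solvable:
  assumes "n > 0" and "abs_trace n (c::'a) = 0"
  obtains y where "y\<^sup>2 + y = c"
proof -
  let ?f = "\<lambda>y::'a. y\<^sup>2 + y"
  have "CARD('a) = card (range ?f) * card {x. ?f x = 0}"
    by (rule card_UNIV_additive) (simp add: square_add add_ac)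
  also have "{x. ?f x = 0} = {0, 1}"
    by (auto simp: artin_schreier_eq_0_iff)
  finally have "card (range ?f) = 2 ^ (n - 1)"
    using assms(1) by (cases n) (simp_all add: card)
  moreover have "range ?f \<subseteq> {x. abs_trace n x = 0}"
    by (auto simp: abs_trace_artin_schreier frob_n add_self)
  ultimately have "range ?f = {x. abs_trace n x = 0}"
    using card_abs_trace_kernel[OF assms(1)] by (intro card_seteq) auto
  then show ?thesis
    using assms(2) that by (metis (mono_tags, lifting) imageE mem_Collect_eq)
qed

section \<open>Reduction to the equation of \<open>sols\<close>\<close>

lemma power_pred_eq_iff:
  fixes y t :: 'a
  assumes "y \<noteq> 0" "y \<noteq> 1"
  shows "y ^ (2 ^ k - 1) + (y + 1) ^ (2 ^ k - 1) = t \<longleftrightarrow> y ^ (2 ^ k) + y = t * (y\<^sup>2 + y)"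
proof -
  have *: "z * z ^ (2 ^ k - 1) = z ^ (2 ^ k)" for z :: 'a
    by (simp flip: power_Suc)
  \<comment> \<open>The factor \<open>y * (y + 1)\<close>, nonzero here, raises both exponents to
    \<open>2 ^ k\<close>, where powers are additive.\<close>
  have "(y\<^sup>2 + y) * (y ^ (2 ^ k - 1) + (y + 1) ^ (2 ^ k - 1))
      = (y + 1) * (y * y ^ (2 ^ k - 1)) + y * ((y + 1) * (y + 1) ^ (2 ^ k - 1))"
    by (simp add: algebra_simps power2_eq_square)
  also have "\<dots> = y ^ (2 ^ k) + y"
    unfolding * frob_add by (simp add: char2_simps)
  finally show ?thesis
    using assms artin_schreier_eq_0_iff[of y] by (metis mult.commute mult_cancel_left)
qed

text \<open>The trivial roots \<open>0\<close> and \<open>1\<close> are left out: they solve the original equation only if \<open>t = 1\<close>.\<close>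
definition sols :: "nat \<Rightarrow> 'a \<Rightarrow> 'a set" where
  "sols m t = {y. y \<noteq> 0 \<and> y \<noteq> 1 \<and> (y ^ (2 ^ m))\<^sup>2 + y = t * (y\<^sup>2 + y)}"

lemma DDT_eq_card_sols:
  assumes "m \<ge> 1"
  shows "DDT (\<lambda>x. x ^ (2 ^ (m + 1) - 1)) 1 (t::'a) = card (sols m t) + (if t = 1 then 2 else 0)"
proof -
  let ?d = "2 ^ (m + 1) - 1 :: nat"
  let ?S = "{y. y ^ ?d + (y + 1) ^ ?d = t}"
  have d: "?d > 0"
    using one_less_power[of "2::nat" "m + 1"] by simp
  have iff: "y \<in> ?S \<longleftrightarrow> y \<in> sols m t" if "y \<noteq> 0" "y \<noteq> 1" for y
    using power_pred_eq_iff[OF that, of "m + 1"] frob_frob[of y m 1] that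
    by (simp add: sols_def)
  \<comment> \<open>One of the two powers is \<open>0\<close>, because \<open>?d\<close> is
    positive, and the other is \<open>1\<close>.\<close>
  have zero_one: "y \<in> ?S \<longleftrightarrow> t = 1" if "y = 0 \<or> y = 1" for y
    using that d by (auto simp: add_self power_0_left)
  have "?S = sols m t \<union> (if t = 1 then {0, 1} else {})"
  proof (rule set_eqI)
    fix y show "y \<in> ?S \<longleftrightarrow> y \<in> sols m t \<union> (if t = 1 then {0, 1} else {})"
      using iff[of y] zero_one[of y] by (cases "y = 0 \<or> y = 1") (auto simp: sols_def)
  qed
  moreover have "sols m t \<inter> {0, 1} = {}"
    by (auto simp: sols_def)
  ultimately show ?thesis
    by (auto simp: DDT_def card_insert_if)
qed


section \<open>Iterated Frobenius, and the case \<open>n = 2 * m + 1\<close>\<close>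

lemma frob_twice_odd:
  assumes "n = 2 * m + 1"
  shows "((x ^ (2 ^ m)) ^ (2 ^ m))\<^sup>2 = (x::'a)" "((x ^ (2 ^ m))\<^sup>2) ^ (2 ^ m) = x"
proof -
  show *: "((x ^ (2 ^ m)) ^ (2 ^ m))\<^sup>2 = x"
    using frob_n[of x] frob_frob[of x "m + m" 1] by (simp add: assms frob_frob mult_2)
  have "(z\<^sup>2) ^ (2 ^ m) = (z ^ (2 ^ m))\<^sup>2" for z :: 'a
    by (simp add: mult.commute flip: power_mult)
  then show "((x ^ (2 ^ m))\<^sup>2) ^ (2 ^ m) = x"
    using * by simp
qed

lemma frob_twice_even:
  assumes "n = 2 * m"
  shows "(x ^ (2 ^ m)) ^ (2 ^ m) = (x::'a)"
  using frob_n[of x] by (simp add: assms frob_frob mult_2)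

text \<open>With \<open>u = y ^ q\<close> and \<open>s = u + y\<close>, the equation and its
  \<open>q\<close>-th power make \<open>y\<^sup>2 + y\<close> and \<open>u\<^sup>2 + u\<close>
  multiples of \<open>s\<close>. Their sum is \<open>s\<^sup>2 + s\<close>, so \<open>s\<close>
  satisfies a quadratic equation without constant term, and \<open>s = 0\<close> is excluded by
  \<open>y\<^sup>2 + y\<close> being nonzero.\<close>

lemma sols_iff_odd:
  fixes t p P :: 'a
  assumes n: "n = 2 * m + 1" and t: "t \<noteq> 0"
  defines "p \<equiv> 1 / t"
  defines "P \<equiv> p ^ (2 ^ m)"
  shows "y \<in> sols m t \<longleftrightarrow>
    y\<^sup>2 + y = p * (1 + p) * (1 + P)\<^sup>2 \<and> y\<^sup>2 + y \<noteq> 0 \<and> y ^ (2 ^ m) + y = (1 + p) * (1 + P)"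
proof -
  define u where "u = y ^ (2 ^ m)"
  have sols: "y \<in> sols m t \<longleftrightarrow> y\<^sup>2 + y \<noteq> 0 \<and> p * (u\<^sup>2 + y) = y\<^sup>2 + y"
  proof -
    have "u\<^sup>2 + y = t * (y\<^sup>2 + y) \<longleftrightarrow> p * (u\<^sup>2 + y) = y\<^sup>2 + y"
      using t by (simp add: p_def divide_eq_eq mult.commute)
    then show ?thesis
      by (auto simp: sols_def artin_schreier_eq_0_iff u_def)
  qed
  show ?thesis
  proof
    assume "y \<in> sols m t"
    then have 0: "y\<^sup>2 + y \<noteq> 0" and E: "p * (u\<^sup>2 + y) = y\<^sup>2 + y"
      by (auto simp: sols)
    define s where "s = u + y"
    have y: "y = u + s"
      by (simp add: s_def char2_simps)
    \<comment> \<open>This is the \<open>q\<close>-th power of \<open>E\<close>; the term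
      \<open>(u\<^sup>2) ^ q\<close> collapses to \<open>y\<close>.\<close>
    have "P * ((u\<^sup>2) ^ (2 ^ m) + u) = u\<^sup>2 + u"
      using arg_cong[OF E, of "\<lambda>z. z ^ (2 ^ m)"]
      by (simp add: power_mult_distrib frob_add P_def u_def mult.commute flip: power_mult)
    then have E': "u\<^sup>2 + u = P * s"
      by (simp add: s_def frob_twice_odd(2)[OF n, of y, folded u_def] add.commute)
    have "y\<^sup>2 + y = p * (u\<^sup>2 + u + s)"
      unfolding E[symmetric] by (simp add: s_def add_ac add_self_left)
    then have A: "y\<^sup>2 + y = p * (1 + P) * s"
      unfolding E' by (simp add: algebra_simps)
    have "s * (s + (1 + p) * (1 + P)) = (y\<^sup>2 + y) + (u\<^sup>2 + u) + p * (1 + P) * s + P * s"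
      by (simp add: s_def char2_simps)
    also have "\<dots> = 0"
      unfolding A E' by (simp add: char2_simps)
    finally have "s = (1 + p) * (1 + P)"
      using 0 A by (auto simp: add_eq_0_iff')
    then show "y\<^sup>2 + y = p * (1 + p) * (1 + P)\<^sup>2 \<and> y\<^sup>2 + y \<noteq> 0 \<and>
        y ^ (2 ^ m) + y = (1 + p) * (1 + P)"
      using 0 A by (simp add: s_def u_def power2_eq_square mult_ac)
  next
    assume "y\<^sup>2 + y = p * (1 + p) * (1 + P)\<^sup>2 \<and> y\<^sup>2 + y \<noteq> 0 \<and>
      y ^ (2 ^ m) + y = (1 + p) * (1 + P)"
    then have 0: "y\<^sup>2 + y \<noteq> 0" and A: "y\<^sup>2 + y = p * (1 + p) * (1 + P)\<^sup>2"
      and s: "u + y = (1 + p) * (1 + P)"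
      by (auto simp: u_def)
    have "u\<^sup>2 + y = (u + y)\<^sup>2 + (y\<^sup>2 + y)"
      by (simp add: char2_simps)
    also have "\<dots> = (1 + p) * (1 + P)\<^sup>2"
      unfolding A s by (simp add: char2_simps)
    finally show "y \<in> sols m t"
      using 0 A by (simp add: sols mult_ac)
  qed
qed

lemma card_sols_odd:
  fixes t c :: 'a
  assumes n: "n = 2 * m + 1" and t: "t \<noteq> 0" "t \<noteq> 1"
  defines "c \<equiv> 1 / t ^ (2 ^ m + 1)"
  shows "abs_trace n c = 1 \<Longrightarrow> card (sols m t) = 2"
    and "abs_trace n c = 0 \<Longrightarrow> card (sols m t) = 0"
proof -
  define p where "p = 1 / t"
  define P where "P = p ^ (2 ^ m)"
  \<comment> \<open>an explicit root of \<open>w\<^sup>2 + w = A\<close>, so that no solvability criterion is needed here\<close>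
  define w where "w = p + (abs_trace m c)\<^sup>2"
  let ?A = "p * (1 + p) * (1 + P)\<^sup>2"
  have c: "c = p * P"
    by (simp add: c_def p_def P_def power_divide field_simps)
  have p01: "p \<noteq> 0" "p \<noteq> 1"
    using t by (auto simp: p_def)
  have P2: "(P ^ (2 ^ m))\<^sup>2 = p"
    using frob_twice_odd(1)[OF n] by (simp add: P_def)
  have "P \<noteq> 1"
    using P2 p01 by auto
  then have A0: "?A \<noteq> 0"
    using p01 by (auto simp: add_eq_0_iff')
  \<comment> \<open>The trace part of \<open>w\<close> contributes
    \<open>(c ^ q + c)\<^sup>2\<close>, and \<open>P2\<close> turns the square of
    \<open>c ^ q\<close> into \<open>P\<^sup>2 * p\<close>.\<close>
  have "w\<^sup>2 + w = p\<^sup>2 + p + ((abs_trace m c)\<^sup>2 + abs_trace m c)\<^sup>2"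
    by (simp add: w_def square_add add_ac)
  also have "\<dots> = p\<^sup>2 + p + (P\<^sup>2 * (P ^ (2 ^ m))\<^sup>2 + (p * P)\<^sup>2)"
    unfolding abs_trace_square_add
    by (simp add: c square_add power_mult_distrib flip: P_def)
  also have "\<dots> = ?A"
    unfolding P2 by (simp add: char2_simps)
  finally have wA: "w\<^sup>2 + w = ?A" .
  \<comment> \<open>Splitting off the first summand leaves the square of
    \<open>abs_trace m c\<close> and its \<open>q\<close>-th power, which are the trace terms of
    \<open>w ^ q + w\<close>.\<close>
  have "abs_trace n c = abs_trace ((1 + m) + m) c"
    by (simp add: n mult_2)
  also have "\<dots> = c + (abs_trace m c)\<^sup>2 + ((abs_trace m c)\<^sup>2) ^ (2 ^ m)"
    unfolding abs_trace_split by (simp add: power_mult) (simp add: abs_trace_def)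
  finally have ww: "w ^ (2 ^ m) + w = abs_trace n c + c + p + P"
    by (simp add: w_def frob_add P_def[symmetric] char2_simps)
  \<comment> \<open>The two roots differ by \<open>1\<close>, which \<open>y ^ q + y\<close> does
    not see: both are solutions or neither is.\<close>
  have yw: "y ^ (2 ^ m) + y = w ^ (2 ^ m) + w" if "y\<^sup>2 + y = ?A" for y
    using that unfolding wA[symmetric] artin_schreier_eq_iff
    by (auto simp: frob_add char2_simps)
  have sols: "y \<in> sols m t \<longleftrightarrow> y\<^sup>2 + y = ?A \<and> y ^ (2 ^ m) + y = (1 + p) * (1 + P)" for y
    using sols_iff_odd[OF n t(1), of y] A0 by (auto simp: p_def P_def)
  have iff: "y \<in> sols m t \<longleftrightarrow> y\<^sup>2 + y = ?A \<and> abs_trace n c = 1" for y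
  proof -
    have "abs_trace n c + c + p + P = (1 + p) * (1 + P) \<longleftrightarrow> abs_trace n c = 1"
      by (simp add: c add_eq_iff) (simp add: char2_simps)
    then show ?thesis
      using sols yw ww by auto
  qed
  show "card (sols m t) = 2" if "abs_trace n c = 1"
  proof -
    have "sols m t = {y. y\<^sup>2 + y = ?A}"
      using iff that by auto
    then show ?thesis
      using card_artin_schreier[OF wA] by simp
  qed
  show "card (sols m t) = 0" if "abs_trace n c = 0"
    using iff that by auto
qed

text \<open>With \<open>u = y ^ q\<close>, the equation says \<open>u\<^sup>2 = y\<close> for
  \<open>t = 0\<close> and \<open>u = y\<close> for \<open>t = 1\<close>. Either way, applying
  Frobenius again gives \<open>y\<^sup>2 = y\<close>.\<close>

lemma sols_empty_odd:
  assumes n: "n = 2 * m + 1" and t: "t = 0 \<or> t = (1::'a)"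
  shows "sols m t = {}"
proof -
  have "y\<^sup>2 + y = 0" if "(y ^ (2 ^ m))\<^sup>2 + y = t * (y\<^sup>2 + y)" for y :: 'a
  proof -
    define u where "u = y ^ (2 ^ m)"
    have u2m: "(u\<^sup>2) ^ (2 ^ m) = y"
      using frob_twice_odd(2)[OF n] by (simp add: u_def)
    have "u\<^sup>2 = y \<or> u\<^sup>2 = y\<^sup>2"
      using that t by (auto simp: u_def add_eq_iff add_self add_self_left char2_simps)
    then show ?thesis
    proof
      assume "u\<^sup>2 = y"
      then show ?thesis
        using u2m by (simp add: add_self flip: u_def)
    next
      assume "u\<^sup>2 = y\<^sup>2"
      then have "u = y"
        by (simp add: square_eq_iff)
      then show ?thesis
        using frob_twice_odd(1)[OF n, of y] by (simp add: add_self flip: u_def)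
    qed
  qed
  then show ?thesis
    unfolding sols_def artin_schreier_eq_0_iff by blast
qed

section \<open>The case \<open>n = 2 * m\<close>\<close>

lemma sols_iff_even:
  fixes t k :: 'a
  assumes n: "n = 2 * m" and k: "k * (1 + t * t ^ (2 ^ m)) = 1"
  defines "T \<equiv> t ^ (2 ^ m)"
  shows "y \<in> sols m t \<longleftrightarrow> y\<^sup>2 + y = (1 + t) * (1 + T)\<^sup>2 * k\<^sup>2 \<and> y\<^sup>2 + y \<noteq> 0 \<and>
    y ^ (2 ^ m) + y = (1 + t) * (1 + T) * k"
proof -
  define u where "u = y ^ (2 ^ m)"
  have u: "u ^ (2 ^ m) = y"
    using frob_twice_even[OF n] by (simp add: u_def)
  have sols: "y \<in> sols m t \<longleftrightarrow> y\<^sup>2 + y \<noteq> 0 \<and> u\<^sup>2 + y = t * (y\<^sup>2 + y)"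
    by (auto simp: sols_def artin_schreier_eq_0_iff u_def)
  show ?thesis
  proof
    assume "y \<in> sols m t"
    then have 0: "y\<^sup>2 + y \<noteq> 0" and E: "u\<^sup>2 + y = t * (y\<^sup>2 + y)"
      by (auto simp: sols)
    define s where "s = u + y"
    \<comment> \<open>The \<open>q\<close>-th power exchanges \<open>y\<close> with \<open>u\<close>
      and \<open>t\<close> with \<open>T\<close>. So \<open>E\<close> and \<open>E'\<close> form a
      linear system in \<open>y\<^sup>2 + y\<close> and \<open>u\<^sup>2 + u\<close> with right-hand
      side \<open>s\<close> and determinant \<open>1 + t * T\<close>, whose inverse is
      \<open>k\<close>.\<close>
    have E': "y\<^sup>2 + u = T * (u\<^sup>2 + u)"
      using arg_cong[OF E, of "\<lambda>z. z ^ (2 ^ m)"] u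
      by (simp add: power_mult_distrib frob_add T_def mult.commute[of 2] power_mult
          flip: u_def power_mult[of _ 2 "2 ^ m"])
    have B: "u\<^sup>2 + u = t * (y\<^sup>2 + y) + s"
      using E by (simp add: s_def add_eq_iff) (simp add: char2_simps)
    have "y\<^sup>2 + y = T * (u\<^sup>2 + u) + s"
      using E' by (simp add: s_def add_eq_iff) (simp add: char2_simps)
    then have "(y\<^sup>2 + y) * (1 + t * T) = s * (1 + T)"
      unfolding B by (simp add: add_eq_iff distrib_left) (simp add: char2_simps)
    then have A: "y\<^sup>2 + y = s * (1 + T) * k"
      using k by (metis T_def mult.assoc mult.commute mult_1_right)
    \<comment> \<open>This second relation is quadratic in \<open>s\<close>; together with
      \<open>A\<close> it determines \<open>s\<close>, which is nonzero.\<close>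
    have "s\<^sup>2 = (y\<^sup>2 + y) + (u\<^sup>2 + u) + s"
      by (simp add: s_def char2_simps)
    also have "\<dots> = (1 + t) * (y\<^sup>2 + y)"
      unfolding B by (simp add: add_ac add_self add_self_left distrib_right)
    also have "\<dots> = s * ((1 + t) * (1 + T) * k)"
      unfolding A by (simp add: mult_ac)
    finally have "s = (1 + t) * (1 + T) * k"
      using 0 A by (auto simp: power2_eq_square)
    then show "y\<^sup>2 + y = (1 + t) * (1 + T)\<^sup>2 * k\<^sup>2 \<and> y\<^sup>2 + y \<noteq> 0 \<and>
        y ^ (2 ^ m) + y = (1 + t) * (1 + T) * k"
      using 0 A by (simp add: s_def u_def power2_eq_square mult_ac)
  next
    assume "y\<^sup>2 + y = (1 + t) * (1 + T)\<^sup>2 * k\<^sup>2 \<and> y\<^sup>2 + y \<noteq> 0 \<and>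
      y ^ (2 ^ m) + y = (1 + t) * (1 + T) * k"
    then have 0: "y\<^sup>2 + y \<noteq> 0" and A: "y\<^sup>2 + y = (1 + t) * (1 + T)\<^sup>2 * k\<^sup>2"
      and s: "u + y = (1 + t) * (1 + T) * k"
      by (auto simp: u_def)
    have "u\<^sup>2 + y = (u + y)\<^sup>2 + (y\<^sup>2 + y)"
      by (simp add: char2_simps)
    also have "\<dots> = t * (y\<^sup>2 + y)"
      unfolding A s by (simp add: char2_simps)
    finally show "y \<in> sols m t"
      using 0 by (simp add: sols)
  qed
qed

text \<open>By telescoping, \<open>y ^ q + y\<close> is the trace of \<open>?A\<close>. Since
  \<open>?A\<close> is \<open>e\<close> plus \<open>g\<^sup>2 + g\<close>, it equals
  \<open>abs_trace m e + (t + T) * k\<close>, while a solution needs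
  \<open>1 + (t + T) * k\<close>.\<close>

lemma card_sols_even:
  fixes t e :: 'a
  assumes m: "m \<ge> 1" and n: "n = 2 * m" and N: "t ^ (2 ^ m + 1) \<noteq> 1"
  defines "e \<equiv> (t ^ (2 ^ m) + t + 1) / (t ^ (2 ^ (m + 1) + 2) + 1)"
  shows "abs_trace m e = 1 \<Longrightarrow> card (sols m t) = 2"
    and "abs_trace m e = 0 \<Longrightarrow> card (sols m t) = 0"
proof -
  define T where "T = t ^ (2 ^ m)"
  define k where "k = 1 / (1 + t * T)"
  define g where "g = T * k"
  let ?A = "(1 + t) * (1 + T)\<^sup>2 * k\<^sup>2"
  have T: "T ^ (2 ^ m) = t"
    using frob_twice_even[OF n] by (simp add: T_def)
  have N0: "1 + t * T \<noteq> 0"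
    using N add_eq_0_iff'[of "t * T" 1] by (simp add: T_def add.commute)
  then have k: "k * (1 + t * T) = 1"
    by (simp add: k_def)
  \<comment> \<open>The denominator \<open>1 + t * T\<close> is symmetric in \<open>t\<close> and
    \<open>T\<close>, which the \<open>q\<close>-th power swaps.\<close>
  have k_frob: "k ^ (2 ^ m) = k"
    by (simp add: k_def power_divide frob_add power_mult_distrib T mult.commute flip: T_def)
  have "t ^ (2 ^ (m + 1) + 2) + 1 = (1 + t * T)\<^sup>2"
    unfolding square_add by (simp add: T_def power2_eq_square power_add mult_2 mult_ac add_ac)
  then have e: "e = (t + T + 1) * k\<^sup>2"
    by (simp add: e_def k_def T_def[symmetric] power_divide add_ac)
  have "t \<noteq> 1" "T \<noteq> 1"
    using N T by auto
  then have A0: "?A \<noteq> 0"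
    using k by (auto simp: add_eq_0_iff')
  have "?A + e = g\<^sup>2 + T * k\<^sup>2 * (1 + t * T)"
    by (simp add: e g_def char2_simps)
  also have "T * k\<^sup>2 * (1 + t * T) = g * (k * (1 + t * T))"
    by (simp add: g_def power2_eq_square mult_ac)
  finally have "?A + e = g\<^sup>2 + g"
    by (simp add: k)
  then have Ae: "?A = e + (g\<^sup>2 + g)"
    by (rule add_eq_iff[THEN iffD1, unfolded add.commute[of e]])
  have s: "(1 + t) * (1 + T) * k = 1 + (t + T) * k"
  proof -
    have "(1 + t) * (1 + T) * k = k * (1 + t * T) + (t + T) * k"
      by (simp add: algebra_simps)
    then show ?thesis
      by (simp add: k)
  qed
  have tr: "y ^ (2 ^ m) + y = abs_trace m e + (t + T) * k" if "y\<^sup>2 + y = ?A" for y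
  proof -
    have "y ^ (2 ^ m) + y = abs_trace m ?A"
      by (simp flip: abs_trace_artin_schreier that)
    also have "\<dots> = abs_trace m e + (g ^ (2 ^ m) + g)"
      unfolding Ae abs_trace_add[of m e] abs_trace_artin_schreier ..
    also have "g ^ (2 ^ m) + g = (t + T) * k"
      by (simp add: g_def power_mult_distrib T k_frob distrib_right)
    finally show ?thesis .
  qed
  have iff: "y \<in> sols m t \<longleftrightarrow> y\<^sup>2 + y = ?A \<and> abs_trace m e = 1" for y
    using sols_iff_even[OF n, of k t y] k A0 tr[of y] s by (auto simp: T_def)
  show "card (sols m t) = 2" if "abs_trace m e = 1"
  proof -
    \<comment> \<open>The trace to the prime field is \<open>1 + 1 = 0\<close>, so \<open>e\<close>
      has an Artin-Schreier root; adding \<open>g\<close> gives a root for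
      \<open>?A\<close>.\<close>
    have "abs_trace n e = abs_trace m e + abs_trace m e ^ (2 ^ m)"
      by (simp add: n mult_2 abs_trace_split)
    then have "abs_trace n e = 0"
      using that by (simp add: add_self)
    then obtain v where "v\<^sup>2 + v = e"
      using artin_schreier_solvable m n by auto
    then have vA: "(v + g)\<^sup>2 + (v + g) = ?A"
      unfolding Ae by (simp add: square_add add_ac)
    have "sols m t = {y. y\<^sup>2 + y = ?A}"
      using iff that by blast
    then show ?thesis
      by (simp only: card_artin_schreier[OF vA])
  qed
  show "card (sols m t) = 0" if "abs_trace m e = 0"
  proof -
    have "sols m t = {}"
      using iff that by auto
    then show ?thesis
      by simp
  qed
qed

text \<open>Here \<open>T\<close> is the inverse of \<open>t\<close>. Multiplying the
  \<open>q\<close>-th power of the equation by \<open>t\<close> and adding the equation leaves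
  \<open>(1 + t) * (u + y) = 0\<close>, so \<open>u = y\<close>, and the equation itself then forces
  \<open>y\<^sup>2 + y = 0\<close>.\<close>

lemma sols_empty_even:
  fixes t :: 'a
  assumes n: "n = 2 * m" and N: "t ^ (2 ^ m + 1) = 1" and t: "t \<noteq> 1"
  shows "sols m t = {}"
proof -
  have "y\<^sup>2 + y = 0" if E: "(y ^ (2 ^ m))\<^sup>2 + y = t * (y\<^sup>2 + y)" for y :: 'a
  proof -
    define u T where "u = y ^ (2 ^ m)" and "T = t ^ (2 ^ m)"
    have u: "u ^ (2 ^ m) = y"
      using frob_twice_even[OF n] by (simp add: u_def)
    have tT: "t * T = 1"
      using N by (simp add: T_def)
    have E0: "u\<^sup>2 + y = t * (y\<^sup>2 + y)"
      using E by (simp add: u_def)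
    have "y\<^sup>2 + u = T * (u\<^sup>2 + u)"
      using arg_cong[OF E0, of "\<lambda>z. z ^ (2 ^ m)"] u
      by (simp add: power_mult_distrib frob_add T_def mult.commute[of 2] power_mult
          flip: u_def power_mult[of _ 2 "2 ^ m"])
    then have "t * (y\<^sup>2 + u) = u\<^sup>2 + u"
      using tT by (simp flip: mult.assoc)
    moreover have "(1 + t) * (u + y)
        = (u\<^sup>2 + y + t * (y\<^sup>2 + y)) + (u\<^sup>2 + u + t * (y\<^sup>2 + u))"
      by (simp add: char2_simps)
    ultimately have "(1 + t) * (u + y) = 0"
      by (simp only: E0 add_self add_0)
    then have "u = y"
      using t by (auto simp: add_eq_0_iff')
    then have "1 * (y\<^sup>2 + y) = t * (y\<^sup>2 + y)"
      using E0 by simp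
    then show ?thesis
      unfolding mult_cancel_right using t by simp
  qed
  then show ?thesis
    unfolding sols_def artin_schreier_eq_0_iff by blast
qed

section \<open>The subfield of order \<open>2 ^ m\<close> and the value \<open>t = 1\<close>\<close>

lemma card_subfield:
  assumes m: "m \<ge> 1" and n: "n = 2 * m"
  shows "card {y::'a. y ^ (2 ^ m) = y} = 2 ^ m"
proof -
  let ?K = "{y::'a. y ^ (2 ^ m) = y}" and ?f = "\<lambda>y::'a. y ^ (2 ^ m) + y"
  have "CARD('a) = card (range ?f) * card {y. ?f y = 0}"
    by (rule card_UNIV_additive) (simp add: frob_add add_ac)
  also have "{y. ?f y = 0} = ?K"
    by (simp add: add_eq_0_iff')
  finally have K: "(2 ^ m)\<^sup>2 = card (range ?f) * card ?K"
    by (simp add: card n mult.commute flip: power_mult)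
  \<comment> \<open>The kernel \<open>?K\<close> contains the range, so the product of their sizes,
    \<open>q\<^sup>2\<close>, is at most the square of the size of \<open>?K\<close>.\<close>
  have "range ?f \<subseteq> ?K"
    by (auto simp: frob_add frob_twice_even[OF n] add.commute)
  then have "card (range ?f) * card ?K \<le> (card ?K)\<^sup>2"
    by (simp add: power2_eq_square card_mono)
  then have "2 ^ m \<le> card ?K"
    unfolding K[symmetric] by (rule power2_le_imp_le) simp
  moreover have "card ?K \<le> 2 ^ m"
  proof -
    let ?p = "monom (1::'a) (2 ^ m) + monom 1 1"
    \<comment> \<open>This keeps the two monomials of \<open>?p\<close> distinct, so they do not
      cancel.\<close>
    have "1 < (2::nat) ^ m"
      using m by (intro one_less_power) auto
    then have coeff: "coeff ?p (2 ^ m) = 1" and "degree ?p \<le> 2 ^ m"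
      by (auto simp: degree_monom_eq intro!: degree_add_le)
    moreover have "?p \<noteq> 0"
    proof
      assume "?p = 0"
      with coeff show False
        by (simp only: coeff_0 zero_neq_one)
    qed
    moreover have "?K = {y. poly ?p y = 0}"
      by (simp add: poly_monom add_eq_0_iff')
    ultimately show ?thesis
      using order.trans[OF card_poly_roots_bound[of ?p], of "2 ^ m"] by (simp only: simp_thms)
  qed
  ultimately show ?thesis
    by simp
qed

text \<open>For \<open>t = 1\<close> the equation says \<open>y ^ q = y\<close>. The
  \<open>2\<close> restores the elements \<open>0\<close> and \<open>1\<close> of the subfield,
  which \<open>sols\<close> omits.\<close>

lemma card_sols_1_even:
  assumes "m \<ge> 1" and "n = 2 * m"
  shows "card (sols m (1::'a)) + 2 = 2 ^ m"
proof -
  have *: "(y ^ (2 ^ m))\<^sup>2 + y = 1 * (y\<^sup>2 + y) \<longleftrightarrow> y ^ (2 ^ m) = y" for y :: 'a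
    by (simp add: square_eq_iff)
  have "sols m 1 = {y::'a. y ^ (2 ^ m) = y} - {0, 1}"
    unfolding sols_def * by blast
  moreover have "{0, 1} \<subseteq> {y::'a. y ^ (2 ^ m) = y}"
    by (simp add: power_0_left)
  ultimately show ?thesis
    using card_subfield[OF assms] card_mono[of "{y::'a. y ^ (2 ^ m) = y}" "{0, 1}"]
    by (simp add: card_Diff_subset)
qed

end

section \<open>Assembly of the cases\<close>

theorem theorem1:
  fixes m n :: nat
    and F :: "'a::{field,finite} \<Rightarrow> 'a"
    and a b :: 'a
  assumes "m \<ge> 1"
    and "n = 2 * m \<or> n = 2 * m + 1"
    and "CARD('a) = 2 ^ n"
    and "F = (\<lambda>x. x ^ (2 ^ (m + 1) - 1))"
  shows
    "(a = 0 \<and> b = 0 \<longrightarrow> DDT F a b = 2 ^ n) \<and>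
     (a = 0 \<and> b \<noteq> 0 \<longrightarrow> DDT F a b = 0) \<and>
     (a \<noteq> 0 \<and> b = 0 \<longrightarrow>
        (n = 2 * m + 1 \<longrightarrow> DDT F a b = 0) \<and>
        (n = 2 * m \<longrightarrow>
           (odd m \<longrightarrow> DDT F a b = 2) \<and>
           (even m \<longrightarrow> DDT F a b = 0))) \<and>
     (a \<noteq> 0 \<and> b \<noteq> 0 \<longrightarrow>
        (let t = b / a ^ (2 ^ (m + 1) - 1) in
          (n = 2 * m + 1 \<longrightarrow>
             (abs_trace n (1 / t ^ (2 ^ m + 1)) = 1 \<longrightarrow> DDT F a b = 2) \<and>
             (abs_trace n (1 / t ^ (2 ^ m + 1)) = 0 \<longrightarrow> DDT F a b = 0)) \<and>
          (n = 2 * m \<longrightarrow>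
             (t = 1 \<longrightarrow> DDT F a b = 2 ^ m) \<and>
             (t ^ (2 ^ m + 1) \<noteq> 1 \<and>
                abs_trace m ((t ^ (2 ^ m) + t + 1) / (t ^ (2 ^ (m + 1) + 2) + 1)) = 1
                \<longrightarrow> DDT F a b = 2) \<and>
             ((t \<noteq> 1 \<and> t ^ (2 ^ m + 1) = 1) \<or>
              (t ^ (2 ^ m + 1) \<noteq> 1 \<and>
                abs_trace m ((t ^ (2 ^ m) + t + 1) / (t ^ (2 ^ (m + 1) + 2) + 1)) = 0)
                \<longrightarrow> DDT F a b = 0))))"
proof -
  interpret binary_field n "TYPE('a)"
    using assms(3) by unfold_locales
  have m: "m \<ge> 1" and F: "F = (\<lambda>x. x ^ (2 ^ (m + 1) - 1))"
    using assms by auto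
  define t where "t = b / a ^ (2 ^ (m + 1) - 1)"
  have zero: "DDT F 0 c = (if c = 0 then 2 ^ n else 0)" for c
    by (auto simp: DDT_def add_self card)
  have DDT: "DDT F a b = card (sols m t) + (if t = 1 then 2 else 0)" if "a \<noteq> 0"
    using DDT_power_reduce[OF that] DDT_eq_card_sols[OF m] unfolding F t_def by metis
  have b0: "(n = 2 * m + 1 \<longrightarrow> DDT F a b = 0) \<and>
      (n = 2 * m \<longrightarrow> (odd m \<longrightarrow> DDT F a b = 2) \<and> (even m \<longrightarrow> DDT F a b = 0))"
    if "a \<noteq> 0" "b = 0"
  proof -
    have "t = 0"
      using that by (simp add: t_def)
    \<comment> \<open>At \<open>t = 0\<close> the trace argument becomes \<open>1\<close>, whose
      trace is the parity of \<open>m\<close>.\<close>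
    then have N: "t ^ (2 ^ m + 1) \<noteq> 1"
      and e: "(t ^ (2 ^ m) + t + 1) / (t ^ (2 ^ (m + 1) + 2) + 1) = 1"
      by (simp_all add: power_0_left)
    show ?thesis
      using DDT[OF that(1)] sols_empty_odd[of m t] card_sols_even[OF m _ N, unfolded e]
        \<open>t = 0\<close> by (auto simp: abs_trace_of_1)
  qed
  have odd: "(abs_trace n (1 / t ^ (2 ^ m + 1)) = 1 \<longrightarrow> DDT F a b = 2) \<and>
      (abs_trace n (1 / t ^ (2 ^ m + 1)) = 0 \<longrightarrow> DDT F a b = 0)"
    if "a \<noteq> 0" "b \<noteq> 0" "n = 2 * m + 1"
  proof (cases "t = 1")
    \<comment> \<open>The trace of \<open>1\<close> is \<open>1\<close> because \<open>n\<close> is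
      odd, and the count \<open>2\<close> comes from the trivial roots alone.\<close>
    case True
    then show ?thesis
      using DDT[OF that(1)] sols_empty_odd[OF that(3), of t] that(3)
      by (simp add: abs_trace_of_1)
  next
    case False
    then show ?thesis
      using DDT[OF that(1)] card_sols_odd[OF that(3), of t] that by (simp add: t_def)
  qed
  have even: "(t = 1 \<longrightarrow> DDT F a b = 2 ^ m) \<and>
      (t ^ (2 ^ m + 1) \<noteq> 1 \<and>
        abs_trace m ((t ^ (2 ^ m) + t + 1) / (t ^ (2 ^ (m + 1) + 2) + 1)) = 1
        \<longrightarrow> DDT F a b = 2) \<and>
      ((t \<noteq> 1 \<and> t ^ (2 ^ m + 1) = 1) \<or>
       (t ^ (2 ^ m + 1) \<noteq> 1 \<and>
        abs_trace m ((t ^ (2 ^ m) + t + 1) / (t ^ (2 ^ (m + 1) + 2) + 1)) = 0)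
        \<longrightarrow> DDT F a b = 0)"
    if "a \<noteq> 0" "n = 2 * m"
  proof -
    have N: "t ^ (2 ^ m + 1) = 1" if "t = 1"
      using that by simp
    have 1: "DDT F a b = 2 ^ m" if "t = 1"
      using DDT[OF \<open>a \<noteq> 0\<close>] card_sols_1_even[OF m \<open>n = 2 * m\<close>] that by simp
    have 2: "DDT F a b = card (sols m t)" if "t \<noteq> 1"
      using DDT[OF \<open>a \<noteq> 0\<close>] that by simp
    have 3: "DDT F a b = 0" if "t \<noteq> 1" "t ^ (2 ^ m + 1) = 1"
      by (simp only: 2[OF that(1)] sols_empty_even[OF \<open>n = 2 * m\<close> that(2,1)] card.empty)
    show ?thesis
      using N 1 2 3 card_sols_even[OF m \<open>n = 2 * m\<close>, of t] by (metis (no_types))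
  qed
  show ?thesis
  proof (cases "a = 0")
    case True
    then show ?thesis
      by (simp add: zero)
  next
    case False
    then show ?thesis
      using b0 odd even unfolding Let_def t_def[symmetric] by blast
  qed
qed

end
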